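(* Let $\varepsilon\ge 0$ and let $S_a=(X_a,X_{a0},U_a,\to_a,Y_a,H_a)$ and $S_b=(X_b,X_{b0},U_b,\to_b,Y_b,H_b)$ be two systems with $Y_a=X_a$, $H_a=1_{X_a}$, $Y_b=X_b$, $H_b=1_{X_b}$. Suppose that $S_b$ is deterministic and that there is a relation $R\subseteq X_a\times X_b$ which is an $\varepsilon$-approximate alternating simulation relation from $S_a$ to $S_b$ and whose inverse $R^{-1}\subseteq X_b\times X_a$ is an $\varepsilon$-approximate simulation relation from $S_b$ to $S_a$. Let $S_{d(a)}$ be the deterministic system associated with $S_a$. Then for any $W\subseteq X_b$ and any $x_{a0}\in X_{a0}$, $x_{b0}\in X_{b0}$ with $(x_{a0},x_{b0})\in R$, $$\tilde{J}(S^*_{cd(a)},\mathcal{F}^*_d,S_{d(a)},\lceil W\rceil_R,x_{a0})\ \le\ \tilde{J}(S^*_{cb},\mathcal{F}^*_b,S_b,W,x_{b0})\ \le\ \tilde{J}(S^*_{ca},\mathcal{F}^*_a,S_a,\lfloor W\rfloor_R,x_{a0}),$$ where $(S^*_{cb},\mathcal{F}^*_b)\in\mathcal{R}(S_b,W)$, $(S^*_{ca},\mathcal{F}^*_a)\in\mathcal{R}(S_a,\lfloor W\rfloor_R)$ and $(S^*_{cd(a)},\mathcal{F}^*_d)\in\mathcal{R}(S_{d(a)},\lceil W\rceil_R)$ are time-optimal controller pairs for $(S_b,W)$, $(S_a,\lfloor W\rfloor_R)$ and $(S_{d(a)},\lceil W\rceil_R)$ respectively.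
   Context: **Systems.** A system $S=(X,X_0,U,\to,Y,H)$ consists of a set of states $X$, a set of initial states $X_0\subseteq X$, a set of inputs $U$, a transition relation $\to\ \subseteq X\times U\times X$, a set of outputs $Y$, and an output map $H:X\to Y$. It is metric if $Y$ is equipped with a metric $\mathbf{d}$. Write $x\xrightarrow{u}x'$ for $(x,u,x')\in\,\to$, $\mathrm{Post}_u(x)=\{x' : x\xrightarrow{u}x'\}$, and $U(x)=\{u\in U : \mathrm{Post}_u(x)\ne\emptyset\}$. $S$ is deterministic if every $\mathrm{Post}_u(x)$ is empty or a singleton. $1_X$ is the identity map on $X$. **Associated deterministic system.** For $S_a=(X_a,X_{a0},U_a,\to_a,Y_a,H_a)$, $S_{d(a)}=(X_a,X_{a0},U_a\times X_a,\to_{d(a)},Y_a,H_a)$, whose transitions are exactly $x\xrightarrow{(u,x')}_{d(a)}x'$ for each transition $x\xrightarrow{u}_a x'$ of $S_a$. **Relations.** For $R\subseteq X_a\times X_b$: $R(x_a)=\{x_b : (x_a,x_b)\in R\}$, $R^{-1}=\{(x_b,x_a) : (x_a,x_b)\in R\}$, and for $W\subseteq X_b$, $$\lfloor W\rfloor_R=\{x_a\in X_a : R(x_a)\subseteq W\},\qquad \lceil W\rceil_R=\{x_a\in X_a : R(x_a)\cap W\ne\emptyset\}.$$ **Approximate simulation and alternating simulation.** Let $S_a,S_b$ be metric systems with $Y_a=Y_b$ (same metric $\mathbf{d}$) and $\varepsilon\ge0$. Consider, for $R\subseteq X_a\times X_b$: (1) for every $x_{a0}\in X_{a0}$ there is $x_{b0}\in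 X_{b0}$ with $(x_{a0},x_{b0})\in R$; (2) $(x_a,x_b)\in R$ implies $\mathbf{d}(H_a(x_a),H_b(x_b))\le\varepsilon$; (3) for every $(x_a,x_b)\in R$ and every $x_a\xrightarrow{u_a}_a x_a'$ there is $x_b\xrightarrow{u_b}_b x_b'$ with $(x_a',x_b')\in R$; (3') for every $(x_a,x_b)\in R$ and every $u_a\in U_a(x_a)$ there is $u_b\in U_b(x_b)$ such that for every $x_b'\in\mathrm{Post}_{u_b}(x_b)$ there is $x_a'\in\mathrm{Post}_{u_a}(x_a)$ with $(x_a',x_b')\in R$. $R$ is an $\varepsilon$-approximate simulation relation from $S_a$ to $S_b$ if (1), (2), (3) hold, and an $\varepsilon$-approximate alternating simulation relation from $S_a$ to $S_b$ if (1), (2), (3') hold. It is called exact if $\varepsilon=0$. Any statement that such a relation exists presupposes that the systems are metric with a common output set. **Extended relation.** For an alternating simulation relation $R$ from $S_a$ to $S_b$, $R^e\subseteq X_a\times X_b\times U_a\times U_b$ is the set of quadruples $(x_a,x_b,u_a,u_b)$ with $(x_a,x_b)\in R$, $u_a\in U_a(x_a)$, $u_b\in U_b(x_b)$, and such that for every $x_b'\in\mathrm{Post}_{u_b}(x_b)$ there is $x_a'\in\mathrm{Post}_{u_a}(x_a)$ with $(x_a',x_b')\in R$. **Feedback composition.** Let $R$ be an exact alternating simulation relation from a system $S_c$ (the controller) to $S_a$ (the plant), with $Y_c=Y_a$, and let $\mathcal{F}=R^e$. The feedback composition $S_c\times_{\mathcal{F}}S_a$ is the system with states $X_{\mathcal{F}}=R$,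 initial states $X_{\mathcal{F}0}=R\cap(X_{c0}\times X_{a0})$, inputs $U_c\times U_a$, transitions $(x_c,x_a)\xrightarrow{(u_c,u_a)}(x_c',x_a')$ (between elements of $R$) iff $x_c\xrightarrow{u_c}_c x_c'$, $x_a\xrightarrow{u_a}_a x_a'$ and $(x_c,x_a,u_c,u_a)\in\mathcal{F}$, output set $Y_c=Y_a$, and output map sending $(x_c,x_a)$ to the common output $H_c(x_c)=H_a(x_a)$. **Behaviors.** A finite (resp. infinite) behavior of $S$ generated from $x\in X$ is a finite sequence $y_0y_1\dots y_n$ (resp. infinite sequence $y_0y_1\dots$) of outputs for which there are states $x_0=x,x_1,\dots$ and inputs $u_0,u_1,\dots$ with $H(x_i)=y_i$ and $x_{i-1}\xrightarrow{u_{i-1}}x_i$ for all relevant $i\ge1$. $\mathcal{B}_x(S)$ and $\mathcal{B}^\omega_x(S)$ denote the sets of finite and infinite behaviors from $x$. Write $\mathbf{y}(k)=y_k$. A behavior is maximal if there is no other behavior (from the same state) containing it as a prefix; in particular infinite behaviors are maximal. **Reachability.** For a system $S_a$ with $Y_a=X_a$, $H_a=1_{X_a}$ and a target $W\subseteq X_a$, $\mathcal{R}(S_a,W)$ is the set of controller pairs $(S_c,\mathcal{F})$, where $\mathcal{F}=R^e$ for an exact alternating simulation relation $R$ from $S_c$ to $S_a$, for which there is $x_0\in X_{\mathcal{F}0}$ such that every maximal behavior $\mathbf{y}\in\mathcal{B}_{x_0}(S_c\times_{\mathcal{F}}S_a)\cup\mathcal{B}^\omega_{x_0}(S_c\times_{\mathcal{F}}S_a)$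 satisfies $\mathbf{y}(k)\in W$ for some $k\in\mathbb{N}$. **Entry time.** For a system $S$, a set $W$ of outputs of $S$ and $x_0\in X_0$, $J(S,W,x_0)$ is the minimum $k\in\mathbb{N}$ (with $0\in\mathbb{N}$) such that for every maximal behavior $\mathbf{y}\in\mathcal{B}_{x_0}(S)\cup\mathcal{B}^\omega_{x_0}(S)$ there is $k'\in[0,k]$ with $\mathbf{y}(k')\in W$; $J(S,W,x_0)=\infty$ if there is no such $k$. For a composition and $x_{a0}\in X_{a0}$, $$\tilde J(S_c,\mathcal{F},S_a,W,x_{a0})=\min_{x_{c0}\in X_{c0}}\{J(S_c\times_{\mathcal{F}}S_a,W,(x_{c0},x_{a0})) : (x_{c0},x_{a0})\in X_{\mathcal{F}0}\},$$ with the minimum over the empty set being $\infty$. **Time-optimal controller pair.** A pair $(S_c^*,\mathcal{F}^* )\in\mathcal{R}(S_a,W)$ is time-optimal for $(S_a,W)$ if for every $(S_c,\mathcal{F})\in\mathcal{R}(S_a,W)$ and every $x_{a0}\in X_{a0}$, $\tilde J(S_c,\mathcal{F},S_a,W,x_{a0})\ge\tilde J(S_c^*,\mathcal{F}^*,S_a,W,x_{a0})$. *)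

theory Defs
  imports
    "HOL-Analysis.Abstract_Metric_Spaces"
    "HOL-Library.Extended_Nat"
    "HOL-Library.Sublist"
begin

section \<open>Systems\<close>

record ('x, 'u, 'y) system =
  states :: "'x set"
  init :: "'x set"
  inputs :: "'u set"
  trans :: "('x \<times> 'u \<times> 'x) set"
  outputs :: "'y set"
  out :: "'x \<Rightarrow> 'y"

definition is_system :: "('x, 'u, 'y) system \<Rightarrow> bool" where
  "is_system S \<longleftrightarrow>
     init S \<subseteq> states S \<and>
     trans S \<subseteq> states S \<times> inputs S \<times> states S \<and>
     out S ` states S \<subseteq> outputs S"

definition post :: "('x, 'u, 'y) system \<Rightarrow> 'u \<Rightarrow> 'x \<Rightarrow> 'x set" where
  "post S u x = {x'. (x, u, x') \<in> trans S}"

definition enabled :: "('x, 'u, 'y) system \<Rightarrow> 'x \<Rightarrow> 'u set" where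
  "enabled S x = {u \<in> inputs S. post S u x \<noteq> {}}"

definition deterministic :: "('x, 'u, 'y) system \<Rightarrow> bool" where
  "deterministic S \<longleftrightarrow>
     (\<forall>x \<in> states S. \<forall>u \<in> inputs S. post S u x = {} \<or> (\<exists>x'. post S u x = {x'}))"

text \<open>\<open>Y = X\<close> and \<open>H = 1\<^sub>X\<close>; outside the carrier, the output map is irrelevant.\<close>

definition state_output :: "('x, 'u, 'x) system \<Rightarrow> bool" where
  "state_output S \<longleftrightarrow> outputs S = states S \<and> (\<forall>x \<in> states S. out S x = x)"

definition det_system :: "('x, 'u, 'y) system \<Rightarrow> ('x, 'u \<times> 'x, 'y) system" where
  "det_system S =
     \<lparr>states = states S, init = init S, inputs = inputs S \<times> states S,
      trans = {(x, (u, x'), x') | x u x'. (x, u, x') \<in> trans S},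
      outputs = outputs S, out = out S\<rparr>"


section \<open>Relations\<close>

text \<open>\<open>R(x)\<close> is written \<open>R `` {x}\<close>. The two operators take the set \<open>X\<^sub>a\<close> as their first
  argument; note that \<open>rel_floor\<close> contains the elements of \<open>X\<^sub>a\<close> without any related element.\<close>

definition rel_floor :: "'a set \<Rightarrow> ('a \<times> 'b) set \<Rightarrow> 'b set \<Rightarrow> 'a set" where
  "rel_floor X R W = {x \<in> X. R `` {x} \<subseteq> W}"

definition rel_ceil :: "'a set \<Rightarrow> ('a \<times> 'b) set \<Rightarrow> 'b set \<Rightarrow> 'a set" where
  "rel_ceil X R W = {x \<in> X. R `` {x} \<inter> W \<noteq> {}}"

text \<open>Conditions shared by both kinds of relation: the two systems are metric with the same set of
  outputs and the same metric \<open>d\<close>, initial states are matched, and related states have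
  \<open>\<epsilon>\<close>-close outputs.\<close>

definition approx_rel ::
  "('y \<Rightarrow> 'y \<Rightarrow> real) \<Rightarrow> real \<Rightarrow> ('a \<times> 'b) set \<Rightarrow> ('a, 'u, 'y) system \<Rightarrow> ('b, 'v, 'y) system \<Rightarrow> bool"
where
  "approx_rel d \<epsilon> R Sa Sb \<longleftrightarrow>
     is_system Sa \<and> is_system Sb \<and> outputs Sa = outputs Sb \<and> Metric_space (outputs Sa) d \<and>
     R \<subseteq> states Sa \<times> states Sb \<and>
     (\<forall>xa0 \<in> init Sa. \<exists>xb0 \<in> init Sb. (xa0, xb0) \<in> R) \<and>
     (\<forall>(xa, xb) \<in> R. d (out Sa xa) (out Sb xb) \<le> \<epsilon>)"

definition approx_sim ::
  "('y \<Rightarrow> 'y \<Rightarrow> real) \<Rightarrow> real \<Rightarrow> ('a \<times> 'b) set \<Rightarrow> ('a, 'u, 'y) system \<Rightarrow> ('b, 'v, 'y) system \<Rightarrow> bool"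
where
  "approx_sim d \<epsilon> R Sa Sb \<longleftrightarrow>
     approx_rel d \<epsilon> R Sa Sb \<and>
     (\<forall>(xa, xb) \<in> R. \<forall>ua xa'. (xa, ua, xa') \<in> trans Sa \<longrightarrow>
        (\<exists>ub xb'. (xb, ub, xb') \<in> trans Sb \<and> (xa', xb') \<in> R))"

definition approx_alt_sim ::
  "('y \<Rightarrow> 'y \<Rightarrow> real) \<Rightarrow> real \<Rightarrow> ('a \<times> 'b) set \<Rightarrow> ('a, 'u, 'y) system \<Rightarrow> ('b, 'v, 'y) system \<Rightarrow> bool"
where
  "approx_alt_sim d \<epsilon> R Sa Sb \<longleftrightarrow>
     approx_rel d \<epsilon> R Sa Sb \<and>
     (\<forall>(xa, xb) \<in> R. \<forall>ua \<in> enabled Sa xa. \<exists>ub \<in> enabled Sb xb.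
        \<forall>xb' \<in> post Sb ub xb. \<exists>xa' \<in> post Sa ua xa. (xa', xb') \<in> R)"

definition extended_rel ::
  "('a \<times> 'b) set \<Rightarrow> ('a, 'u, 'y) system \<Rightarrow> ('b, 'v, 'y) system \<Rightarrow> ('a \<times> 'b \<times> 'u \<times> 'v) set"
where
  "extended_rel R Sa Sb =
     {(xa, xb, ua, ub). (xa, xb) \<in> R \<and> ua \<in> enabled Sa xa \<and> ub \<in> enabled Sb xb \<and>
        (\<forall>xb' \<in> post Sb ub xb. \<exists>xa' \<in> post Sa ua xa. (xa', xb') \<in> R)}"


section \<open>Feedback composition\<close>

text \<open>The composition of \<open>Sc\<close> and \<open>Sa\<close> with \<open>\<F> = R\<^sup>e\<close>. Its state set is \<open>R\<close>, which \<open>R\<^sup>e\<close> does not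
  determine: a pair of \<open>R\<close> whose controller state enables no input leaves no trace in \<open>R\<^sup>e\<close>.
  Therefore the interconnection is given by \<open>R\<close>, and \<open>\<F>\<close> is computed from it; likewise, a
  controller pair \<open>(Sc, \<F>)\<close> is represented below by \<open>(Sc, R)\<close>.\<close>

definition feedback ::
  "('c, 'v, 'y) system \<Rightarrow> ('c \<times> 'x) set \<Rightarrow> ('x, 'u, 'y) system \<Rightarrow> ('c \<times> 'x, 'v \<times> 'u, 'y) system"
where
  "feedback Sc R Sa =
     \<lparr>states = R,
      init = R \<inter> (init Sc \<times> init Sa),
      inputs = inputs Sc \<times> inputs Sa,
      trans = {((xc, xa), (uc, ua), (xc', xa')) | xc xa uc ua xc' xa'.
                 (xc, xa) \<in> R \<and> (xc', xa') \<in> R \<and>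
                 (xc, uc, xc') \<in> trans Sc \<and> (xa, ua, xa') \<in> trans Sa \<and>
                 (xc, xa, uc, ua) \<in> extended_rel R Sc Sa},
      outputs = outputs Sc,
      out = (\<lambda>(xc, xa). out Sc xc)\<rparr>"


section \<open>Behaviors\<close>

datatype 'y behavior = Finite "'y list" | Infinite "nat \<Rightarrow> 'y"

text \<open>A run with \<open>n\<close> transitions, where \<open>n = \<infinity>\<close> is allowed; only \<open>\<xi> i\<close> for \<open>i \<le> n\<close> and \<open>\<upsilon> i\<close>
  for \<open>i < n\<close> are constrained.\<close>

definition is_run ::
  "('x, 'u, 'y) system \<Rightarrow> 'x \<Rightarrow> enat \<Rightarrow> (nat \<Rightarrow> 'x) \<Rightarrow> (nat \<Rightarrow> 'u) \<Rightarrow> bool"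
where
  "is_run S x n \<xi> \<upsilon> \<longleftrightarrow>
     x \<in> states S \<and> \<xi> 0 = x \<and> (\<forall>i. enat i < n \<longrightarrow> (\<xi> i, \<upsilon> i, \<xi> (Suc i)) \<in> trans S)"

definition behaviors :: "('x, 'u, 'y) system \<Rightarrow> 'x \<Rightarrow> 'y behavior set" where
  "behaviors S x =
     {Finite (map (\<lambda>i. out S (\<xi> i)) [0..<Suc n]) | n \<xi> \<upsilon>. is_run S x (enat n) \<xi> \<upsilon>} \<union>
     {Infinite (\<lambda>i. out S (\<xi> i)) | \<xi> \<upsilon>. is_run S x \<infinity> \<xi> \<upsilon>}"

fun proper_prefix :: "'y behavior \<Rightarrow> 'y behavior \<Rightarrow> bool" where
  "proper_prefix (Finite ys) (Finite zs) \<longleftrightarrow> strict_prefix ys zs"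
| "proper_prefix (Finite ys) (Infinite z) \<longleftrightarrow> (\<forall>i < length ys. ys ! i = z i)"
| "proper_prefix (Infinite y) b \<longleftrightarrow> False"

definition maximal_behaviors :: "('x, 'u, 'y) system \<Rightarrow> 'x \<Rightarrow> 'y behavior set" where
  "maximal_behaviors S x = {b \<in> behaviors S x. \<not> (\<exists>b' \<in> behaviors S x. proper_prefix b b')}"

text \<open>\<open>in_at b k W\<close>: the \<open>k\<close>-th output of \<open>b\<close> exists and lies in \<open>W\<close>.\<close>

fun in_at :: "'y behavior \<Rightarrow> nat \<Rightarrow> 'y set \<Rightarrow> bool" where
  "in_at (Finite ys) k W \<longleftrightarrow> k < length ys \<and> ys ! k \<in> W"
| "in_at (Infinite y) k W \<longleftrightarrow> y k \<in> W"


section \<open>Reachability and entry times\<close>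

text \<open>The type \<open>'c\<close> of controller states and the type \<open>'v\<close> of controller inputs are parameters of
  the following notions, since one cannot quantify over all types inside a formula.\<close>

definition reach_pairs ::
  "('x \<Rightarrow> 'x \<Rightarrow> real) \<Rightarrow> ('x, 'u, 'x) system \<Rightarrow> 'x set \<Rightarrow>
   (('c, 'v, 'x) system \<times> ('c \<times> 'x) set) set"
where
  "reach_pairs d Sa W =
     {(Sc, R). approx_alt_sim d 0 R Sc Sa \<and>
        (\<exists>x0 \<in> init (feedback Sc R Sa).
           \<forall>b \<in> maximal_behaviors (feedback Sc R Sa) x0. \<exists>k. in_at b k W)}"

definition entry_time :: "('x, 'u, 'y) system \<Rightarrow> 'y set \<Rightarrow> 'x \<Rightarrow> enat" where
  "entry_time S W x0 =
     (let P = (\<lambda>k. \<forall>b \<in> maximal_behaviors S x0. \<exists>k' \<le> k. in_at b k' W)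
      in if \<exists>k. P k then enat (LEAST k. P k) else \<infinity>)"

text \<open>In \<open>enat\<close>, the infimum of a nonempty set is its minimum, and that of the empty set is \<open>\<infinity>\<close>.\<close>

definition comp_entry_time ::
  "('c, 'v, 'x) system \<Rightarrow> ('c \<times> 'x) set \<Rightarrow> ('x, 'u, 'x) system \<Rightarrow> 'x set \<Rightarrow> 'x \<Rightarrow> enat"
where
  "comp_entry_time Sc R Sa W xa0 =
     Inf {entry_time (feedback Sc R Sa) W (xc0, xa0) | xc0.
            xc0 \<in> init Sc \<and> (xc0, xa0) \<in> init (feedback Sc R Sa)}"

text \<open>The competitors are the controllers with states in \<open>'c\<close> and inputs in \<open>'v\<close>. A pair that is
  optimal among all controllers is also optimal in this sense, for every choice of types that
  can represent it, so results assuming this form of optimality apply to it. For finite \<open>'c\<close> the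
  notion degenerates (a small controller can be optimal among small controllers only). For infinite
  \<open>'c\<close> and a deterministic plant it is equivalent to optimality among all controllers, because
  countably many controller states suffice to realize the best entry time from a given state.\<close>

definition time_optimal ::
  "('x \<Rightarrow> 'x \<Rightarrow> real) \<Rightarrow> ('x, 'u, 'x) system \<Rightarrow> 'x set \<Rightarrow>
   ('c, 'v, 'x) system \<Rightarrow> ('c \<times> 'x) set \<Rightarrow> bool"
where
  "time_optimal d Sa W Sc' R' \<longleftrightarrow>
     (Sc', R') \<in> reach_pairs d Sa W \<and>
     (\<forall>(Sc :: ('c, 'v, 'x) system, R) \<in> reach_pairs d Sa W. \<forall>xa0 \<in> init Sa.
        comp_entry_time Sc R Sa W xa0 \<ge> comp_entry_time Sc' R' Sa W xa0)"

end

theory Submission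
  imports Defs
begin

text \<open>Maximality concerns output sequences, so a controller may follow an infinite run of a
  deterministic plant by nondeterministically choosing a finite number of steps after which it
  blocks: all its behaviors are the finite prefixes of one sequence and none of them is maximal, so
  its entry time is \<open>0\<close>. The best entry time of a deterministic plant from an initial state is
  therefore \<open>0\<close> if there is an infinite run from it, and the length of a shortest run into the
  target otherwise. Conversely, a composition with entry time at most \<open>k\<close> is matched step by step
  through the given relation by a run of the other plant. A matching run goes on as long as the
  output sequence produced so far is not maximal. Hence it is infinite, or it reaches the target in
  at most \<open>k\<close> steps, and in both cases the optimal controller of the other plant is at least as
  fast.\<close>

section \<open>Entry times and matching runs\<close>

text \<open>The admissible bounds are upward closed, so the least one is at most \<open>k\<close>
  exactly when \<open>k\<close> itself is admissible. Later arguments use this form and never meet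
  the least element again.\<close>

lemma entry_time_le_iff:
  "entry_time S W x \<le> enat k \<longleftrightarrow> (\<forall>b \<in> maximal_behaviors S x. \<exists>k' \<le> k. in_at b k' W)"
proof -
  let ?P = "\<lambda>k. \<forall>b \<in> maximal_behaviors S x. \<exists>k' \<le> k. in_at b k' W"
  have mono: "?P k" if "?P j" "j \<le> k" for j
    using that order_trans by metis
  show ?thesis
  proof (cases "\<exists>j. ?P j")
    case True
    then have "?P (LEAST j. ?P j)" by (rule LeastI_ex)
    then have "(LEAST j. ?P j) \<le> k \<longleftrightarrow> ?P k"
      using mono[of "LEAST j. ?P j"] Least_le[of ?P k] by blast
    then show ?thesis using True by (simp add: entry_time_def)
  next
    case False
    then have "entry_time S W x = \<infinity>" unfolding entry_time_def Let_def by (simp only: if_False)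
    with False show ?thesis by (metis infinity_ileE)
  qed
qed

text \<open>A finite infimum is not that of the empty set, and it is attained because
  \<open>enat\<close> is well-ordered.\<close>

lemma comp_entry_time_leD:
  assumes "comp_entry_time Sc Rc S W x \<le> enat k"
  obtains c where "c \<in> init Sc" "(c, x) \<in> init (feedback Sc Rc S)"
    "entry_time (feedback Sc Rc S) W (c, x) \<le> enat k"
proof -
  let ?A = "{entry_time (feedback Sc Rc S) W (c, x) | c.
               c \<in> init Sc \<and> (c, x) \<in> init (feedback Sc Rc S)}"
  have "Inf ?A \<noteq> \<infinity>" using assms unfolding comp_entry_time_def by (metis infinity_ileE)
  then have "?A \<noteq> {}" unfolding Inf_enat_def by metis
  then obtain a where "a \<in> ?A" by blast
  then have "Inf ?A \<in> ?A" by (rule wellorder_InfI)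
  then obtain c where c: "c \<in> init Sc" "(c, x) \<in> init (feedback Sc Rc S)"
    "Inf ?A = entry_time (feedback Sc Rc S) W (c, x)" by blast
  show ?thesis
  proof (rule that)
    show "entry_time (feedback Sc Rc S) W (c, x) \<le> enat k"
      using assms unfolding comp_entry_time_def c(3) .
  qed (fact c)+
qed

section \<open>Prolonging output words that are not maximal\<close>

lemma finite_behavior_iff:
  "Finite ys \<in> behaviors S x \<longleftrightarrow>
     (\<exists>n \<xi> \<upsilon>. is_run S x (enat n) \<xi> \<upsilon> \<and> ys = map (\<lambda>i. out S (\<xi> i)) [0..<Suc n])"
  by (auto simp: behaviors_def simp del: upt_Suc)

text \<open>A longer behavior with prefix \<open>ys\<close> comes from a run that can be cut after
  \<open>Suc n\<close> steps. This run need not extend the one that first produced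
  \<open>ys\<close>; the two agree in their outputs only.\<close>

lemma not_maximalE:
  assumes "Finite ys \<in> behaviors S x" "Finite ys \<notin> maximal_behaviors S x" "length ys = Suc n"
  obtains \<xi> \<upsilon> where "is_run S x (enat (Suc n)) \<xi> \<upsilon>" "ys = map (\<lambda>i. out S (\<xi> i)) [0..<Suc n]"
proof -
  obtain b where b: "b \<in> behaviors S x" "proper_prefix (Finite ys) b"
    using assms(1,2) by (auto simp: maximal_behaviors_def)
  show ?thesis
  proof (cases b)
    case (Finite zs)
    then obtain m \<xi> \<upsilon> where run: "is_run S x (enat m) \<xi> \<upsilon>"
      and zs: "zs = map (\<lambda>i. out S (\<xi> i)) [0..<Suc m]"
      using b(1) by (auto simp: finite_behavior_iff simp del: upt_Suc)
    have pre: "strict_prefix ys zs" using b(2) Finite by simp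
    then have len: "Suc n < Suc m"
      using prefix_length_less[OF pre] assms(3) zs by (simp del: upt_Suc)
    have "ys = take (Suc n) zs"
      using pre assms(3) by (metis append_eq_conv_conj prefix_def strict_prefix_def)
    also have "\<dots> = map (\<lambda>i. out S (\<xi> i)) [0..<Suc n]"
      using len unfolding zs by (simp add: take_map del: upt_Suc)
    finally have "ys = map (\<lambda>i. out S (\<xi> i)) [0..<Suc n]" .
    moreover have "is_run S x (enat (Suc n)) \<xi> \<upsilon>"
      using run len by (auto simp: is_run_def)
    ultimately show ?thesis using that by blast
  next
    case (Infinite z)
    then obtain \<xi> \<upsilon> where run: "is_run S x \<infinity> \<xi> \<upsilon>" and z: "z = (\<lambda>i. out S (\<xi> i))"
      using b(1) by (auto simp: behaviors_def)
    have "ys = map (\<lambda>i. out S (\<xi> i)) [0..<Suc n]"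
      using b(2) assms(3) Infinite z by (intro nth_equalityI) (auto simp del: upt_Suc)
    moreover have "is_run S x (enat (Suc n)) \<xi> \<upsilon>"
      using run by (auto simp: is_run_def)
    ultimately show ?thesis using that by blast
  qed
qed

text \<open>If no such run existed, every matched output word could be prolonged: a maximal one
  would meet \<open>V\<close> by time \<open>k\<close>, and its matching path would then enter
  \<open>W\<close> by time \<open>k\<close>. Prolonging forever gives an infinite run of
  \<open>P\<close>, which is also of the desired kind. \<open>Q\<close> compares outputs of
  \<open>T\<close>, not states, because the run behind a word may change at each stage.\<close>

lemma entry_time_matching_run:
  fixes T :: "('s, 'u, 'y) system" and P :: "('z, 'v, 'w) system"
  assumes entry: "entry_time T V x0 \<le> enat k"
    and x0: "x0 \<in> states T" and z0: "z0 \<in> states P" and Q0: "(out T x0, z0) \<in> Q"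
    and step: "\<And>x u x' z. (x, u, x') \<in> trans T \<Longrightarrow> (out T x, z) \<in> Q \<Longrightarrow>
      \<exists>u x' v z'. (x, u, x') \<in> trans T \<and> (z, v, z') \<in> trans P \<and> (out T x', z') \<in> Q"
    and target: "\<And>y z. y \<in> V \<Longrightarrow> (y, z) \<in> Q \<Longrightarrow> z \<in> W"
  shows "\<exists>n \<zeta> \<upsilon>. is_run P z0 n \<zeta> \<upsilon> \<and> (\<forall>m. n = enat m \<longrightarrow> m \<le> k \<and> \<zeta> m \<in> W)"
proof (rule ccontr)
  assume none: "\<not> ?thesis"
  \<comment> \<open>Only the word \<open>ys\<close> is remembered on the side of \<open>T\<close>;
    on the side of \<open>P\<close> the whole path \<open>zs\<close> is kept. Accordingly
    \<open>ext\<close> controls the growth of the path alone, as only the path is taken to the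
    limit.\<close>
  define good where "good n s \<longleftrightarrow>
      (case s of (ys, zs) \<Rightarrow> Finite ys \<in> behaviors T x0 \<and> length ys = Suc n \<and>
         list_all2 (\<lambda>y z. (y, z) \<in> Q) ys zs \<and> zs ! 0 = z0 \<and>
         (\<forall>i < n. \<exists>v. (zs ! i, v, zs ! Suc i) \<in> trans P))" for n s
  define ext where "ext s s' \<longleftrightarrow> (\<exists>z. snd s' = snd s @ [z])" for s s' :: "'y list \<times> 'z list"
  have "\<exists>f. \<forall>n. good n (f n) \<and> ext (f n) (f (Suc n))"
  proof (rule dependent_nat_choice)
    have "is_run T x0 (enat 0) (\<lambda>_. x0) \<upsilon>" for \<upsilon>
      using x0 by (simp add: is_run_def zero_enat_def[symmetric])
    then have "Finite [out T x0] \<in> behaviors T x0"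
      unfolding finite_behavior_iff by (intro exI[of _ 0]) auto
    then have "good 0 ([out T x0], [z0])"
      using Q0 by (simp add: good_def)
    then show "\<exists>s. good 0 s" by blast
  next
    fix s n assume "good n s"
    then obtain ys zs where s: "s = (ys, zs)" and ys: "Finite ys \<in> behaviors T x0" "length ys = Suc n"
      and zs: "list_all2 (\<lambda>y z. (y, z) \<in> Q) ys zs" "zs ! 0 = z0"
      and path: "\<And>i. i < n \<Longrightarrow> \<exists>v. (zs ! i, v, zs ! Suc i) \<in> trans P"
      by (auto simp: good_def)
    have len: "length zs = Suc n" using ys(2) zs(1) by (simp add: list_all2_lengthD)
    \<comment> \<open>Otherwise \<open>ys\<close> meets \<open>V\<close> at some \<open>k'\<close>
      within the bound, and the first \<open>k'\<close> steps of \<open>zs\<close> form a run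
      excluded by \<open>none\<close>.\<close>
    have "Finite ys \<notin> maximal_behaviors T x0"
    proof
      assume "Finite ys \<in> maximal_behaviors T x0"
      then obtain k' where k': "k' \<le> k" "k' < length ys" "ys ! k' \<in> V"
        using entry unfolding entry_time_le_iff by fastforce
      then have "zs ! k' \<in> W"
        using target zs(1) by (metis list_all2_nthD)
      obtain \<upsilon> where "\<And>i. i < n \<Longrightarrow> (zs ! i, \<upsilon> i, zs ! Suc i) \<in> trans P"
        using path by metis
      then have "is_run P z0 (enat k') (\<lambda>i. zs ! i) \<upsilon>"
        using z0 zs(2) k'(2) ys(2) by (auto simp: is_run_def)
      with none k'(1) \<open>zs ! k' \<in> W\<close> show False by blast
    qed
    then obtain \<xi> \<upsilon> where run: "is_run T x0 (enat (Suc n)) \<xi> \<upsilon>"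
      and ys_eq: "ys = map (\<lambda>i. out T (\<xi> i)) [0..<Suc n]"
      using not_maximalE[OF ys(1) _ ys(2)] by blast
    have "(\<xi> n, \<upsilon> n, \<xi> (Suc n)) \<in> trans T" using run by (simp add: is_run_def)
    moreover have "(out T (\<xi> n), zs ! n) \<in> Q"
      using list_all2_nthD[OF zs(1), of n] ys(2) by (simp add: ys_eq nth_append)
    ultimately obtain u x' v z' where new: "(\<xi> n, u, x') \<in> trans T" "(zs ! n, v, z') \<in> trans P"
      "(out T x', z') \<in> Q"
      using step by blast
    \<comment> \<open>The transition supplied by \<open>step\<close> may differ from the last one of
      the run, so the final input and state are overwritten. The word \<open>ys\<close> stays the
      same, since it stops at index \<open>n\<close>.\<close>
    have "is_run T x0 (enat (Suc n)) (\<xi>(Suc n := x')) (\<upsilon>(n := u))"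
      using run new(1) by (auto simp: is_run_def)
    moreover have "ys @ [out T x'] = map (\<lambda>i. out T ((\<xi>(Suc n := x')) i)) [0..<Suc (Suc n)]"
      by (simp add: ys_eq)
    ultimately have "Finite (ys @ [out T x']) \<in> behaviors T x0"
      unfolding finite_behavior_iff by blast
    moreover have "\<exists>v. ((zs @ [z']) ! i, v, (zs @ [z']) ! Suc i) \<in> trans P" if "i < Suc n" for i
      using that path new(2) len by (cases "i = n") (auto simp: nth_append)
    ultimately have "good (Suc n) (ys @ [out T x'], zs @ [z'])"
      using ys(2) zs new(3) len by (auto simp: good_def nth_append list_all2_appendI)
    moreover have "ext s (ys @ [out T x'], zs @ [z'])" by (simp add: ext_def s)
    ultimately show "\<exists>s'. good (Suc n) s' \<and> ext s s'" by blast
  qed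
  then obtain f where f: "\<And>n. good n (f n)" "\<And>n. ext (f n) (f (Suc n))" by blast
  \<comment> \<open>Entry \<open>n\<close> no longer changes from stage \<open>n\<close> on, so the
    diagonal is an infinite path.\<close>
  define \<zeta> where "\<zeta> n = snd (f n) ! n" for n
  have "\<exists>v. (\<zeta> n, v, \<zeta> (Suc n)) \<in> trans P" for n
  proof -
    have "length (snd (f n)) = Suc n"
      using f(1)[of n] by (auto simp: good_def dest: list_all2_lengthD split: prod.splits)
    then have "\<zeta> n = snd (f (Suc n)) ! n"
      using f(2)[of n] by (auto simp: \<zeta>_def ext_def nth_append)
    then show ?thesis
      using f(1)[of "Suc n"] by (auto simp: good_def \<zeta>_def split: prod.splits)
  qed
  then obtain \<upsilon> where "\<And>n. (\<zeta> n, \<upsilon> n, \<zeta> (Suc n)) \<in> trans P" by metis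
  moreover have "\<zeta> 0 = z0"
    using f(1)[of 0] by (auto simp: good_def \<zeta>_def split: prod.splits)
  ultimately have "is_run P z0 \<infinity> \<zeta> \<upsilon>" using z0 by (simp add: is_run_def)
  with none show False by blast
qed


section \<open>A controller following a run\<close>

text \<open>A state \<open>e (i, m)\<close> is at position \<open>i\<close> of the run \<open>p\<close> and blocks at position \<open>m\<close>; the bound
  \<open>m\<close> is chosen in the first step. For \<open>n = \<infinity>\<close> every run of the controller is finite, but the
  lengths of its runs from \<open>e (0, 0)\<close> are unbounded.\<close>

definition chain_controller ::
  "(nat \<times> nat \<Rightarrow> 'c) \<Rightarrow> (nat \<Rightarrow> 'y) \<Rightarrow> enat \<Rightarrow> 'y set \<Rightarrow> ('c, 'v, 'y) system"
where
  "chain_controller e p n Y =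
     \<lparr>states = e ` {(i, m). i \<le> m \<and> enat m \<le> n}, init = {e (0, 0)}, inputs = UNIV,
      trans = {(e (i, m), u, e (Suc i, m')) | i m u m'. i \<le> m \<and> enat m \<le> n \<and>
                 Suc i \<le> m' \<and> enat m' \<le> n \<and> (i = 0 \<or> m' = m)},
      outputs = Y, out = (\<lambda>c. p (fst (inv e c)))\<rparr>"

definition chain_rel :: "(nat \<times> nat \<Rightarrow> 'c) \<Rightarrow> (nat \<Rightarrow> 'y) \<Rightarrow> enat \<Rightarrow> ('c \<times> 'y) set" where
  "chain_rel e p n = {(e (i, m), p i) | i m. i \<le> m \<and> enat m \<le> n}"

text \<open>The injection \<open>e\<close> stores pairs of position and bound in the controller
  type. Finite and infinite runs are treated together, with \<open>n\<close> as their
  length.\<close>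

locale followed_run =
  fixes e :: "nat \<times> nat \<Rightarrow> 'c" and S :: "('x, 'u, 'x) system" and x0 :: 'x
    and n :: enat and p :: "nat \<Rightarrow> 'x" and \<upsilon> :: "nat \<Rightarrow> 'u" and d :: "'x \<Rightarrow> 'x \<Rightarrow> real"
  assumes inj: "inj e" and sys: "is_system S" and det: "deterministic S"
    and so: "state_output S" and met: "Metric_space (states S) d"
    and init: "x0 \<in> init S" and run: "is_run S x0 n p \<upsilon>"
begin

abbreviation C :: "('c, 'v, 'x) system" where
  "C \<equiv> chain_controller e p n (states S)"

abbreviation Rel :: "('c \<times> 'x) set" where
  "Rel \<equiv> chain_rel e p n"

section \<open>Transitions of the run and of its controller\<close>

lemma p_trans: "enat i < n \<Longrightarrow> (p i, \<upsilon> i, p (Suc i)) \<in> trans S"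
  using run by (simp add: is_run_def)

lemma p_0: "p 0 = x0"
  using run by (simp add: is_run_def)

lemma p_states: "enat i \<le> n \<Longrightarrow> p i \<in> states S"
proof (cases i)
  case 0
  then show ?thesis using run by (simp add: is_run_def)
next
  case (Suc j)
  assume "enat i \<le> n"
  then have "enat j < n" using Suc by (metis Suc_ile_eq)
  then show ?thesis using p_trans[of j] sys Suc by (auto simp: is_system_def)
qed

lemma e_eq: "e a = e b \<longleftrightarrow> a = b"
  using inj by (simp add: inj_eq)

lemma out_C: "out C (e (i, m)) = p i"
  using inj by (simp add: chain_controller_def)

lemma Rel_iff: "(e (i, m), x) \<in> Rel \<longleftrightarrow> i \<le> m \<and> enat m \<le> n \<and> x = p i"
  by (auto simp: chain_rel_def e_eq)

lemma trans_C_iff: "(e (i, m), u, c) \<in> trans (C :: ('c, 'v, 'x) system) \<longleftrightarrow>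
    (\<exists>m'. c = e (Suc i, m') \<and> i \<le> m \<and> enat m \<le> n \<and> Suc i \<le> m' \<and> enat m' \<le> n \<and> (i = 0 \<or> m' = m))"
  by (auto simp: chain_controller_def e_eq)

lemma less_n: "Suc i \<le> m \<Longrightarrow> enat m \<le> n \<Longrightarrow> enat i < n"
  by (meson Suc_ile_eq enat_ord_simps(1) order_trans)

lemma le_n: "i \<le> m \<Longrightarrow> enat m \<le> n \<Longrightarrow> enat i \<le> n"
  by (meson enat_ord_simps(1) order_trans)

text \<open>Determinism leaves \<open>p (Suc i)\<close> as the only successor, so the input
  \<open>\<upsilon> i\<close> forces the plant along the run.\<close>

lemma post_p:
  assumes "enat i < n"
  shows "post S (\<upsilon> i) (p i) = {p (Suc i)}" "\<upsilon> i \<in> enabled S (p i)"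
proof -
  have t: "p (Suc i) \<in> post S (\<upsilon> i) (p i)" "p i \<in> states S" "\<upsilon> i \<in> inputs S"
    using p_trans[OF assms] sys by (auto simp: post_def is_system_def)
  then have "post S (\<upsilon> i) (p i) = {} \<or> (\<exists>x'. post S (\<upsilon> i) (p i) = {x'})"
    using det by (simp add: deterministic_def)
  with t(1) show "post S (\<upsilon> i) (p i) = {p (Suc i)}" by auto
  with t(3) show "\<upsilon> i \<in> enabled S (p i)" by (simp add: enabled_def)
qed

text \<open>Related states share the position \<open>i\<close>, hence the output \<open>p i\<close>.
  Whenever the controller can move, the plant answers with \<open>\<upsilon> i\<close>, whose only
  successor is related to the next controller state.\<close>

lemma chain_alt_sim: "approx_alt_sim d 0 Rel (C :: ('c, 'v, 'x) system) S"
proof -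
  interpret Metric_space "states S" d by (fact met)
  let ?C = "C :: ('c, 'v, 'x) system"
  have "is_system ?C"
    unfolding is_system_def
  proof (intro conjI)
    show "init ?C \<subseteq> states ?C"
      by (simp add: chain_controller_def zero_enat_def[symmetric])
    show "trans ?C \<subseteq> states ?C \<times> inputs ?C \<times> states ?C"
      by (auto simp: chain_controller_def intro!: imageI)
    show "out ?C ` states ?C \<subseteq> outputs ?C"
    proof clarify
      fix c assume "c \<in> states ?C"
      then obtain i m where "c = e (i, m)" "i \<le> m" "enat m \<le> n"
        by (auto simp: chain_controller_def)
      then show "out ?C c \<in> outputs ?C"
        using p_states[OF le_n] out_C[of i m] by (simp add: chain_controller_def)
    qed
  qed
  moreover have "outputs ?C = outputs S"
    using so by (simp add: chain_controller_def state_output_def)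
  moreover have "Rel \<subseteq> states ?C \<times> states S"
    using p_states le_n by (auto simp: chain_rel_def chain_controller_def)
  moreover have "\<forall>c \<in> init ?C. \<exists>x \<in> init S. (c, x) \<in> Rel"
    using init p_0 Rel_iff[of 0 0 x0]
    by (auto simp: chain_controller_def zero_enat_def[symmetric])
  moreover have "\<forall>(c, x) \<in> Rel. d (out ?C c) (out S x) \<le> 0"
  proof clarify
    fix c x assume "(c, x) \<in> Rel"
    then obtain i m where "c = e (i, m)" "i \<le> m" "enat m \<le> n" "x = p i"
      by (auto simp: chain_rel_def)
    then show "d (out ?C c) (out S x) \<le> 0"
      using so p_states le_n by (simp add: out_C state_output_def)
  qed
  moreover have "\<forall>(c, x) \<in> Rel. \<forall>uc \<in> enabled ?C c. \<exists>ub \<in> enabled S x.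
      \<forall>x' \<in> post S ub x. \<exists>c' \<in> post ?C uc c. (c', x') \<in> Rel"
  proof clarify
    fix c x uc assume rel: "(c, x) \<in> Rel" and en: "uc \<in> enabled ?C c"
    obtain i m where c: "c = e (i, m)" "i \<le> m" "enat m \<le> n" "x = p i"
      using rel by (auto simp: chain_rel_def)
    \<comment> \<open>An enabled move provides a bound \<open>m'\<close> between
      \<open>Suc i\<close> and \<open>n\<close>, which shows that the run has not ended at position
      \<open>i\<close>.\<close>
    obtain m' where m': "Suc i \<le> m'" "enat m' \<le> n" "e (Suc i, m') \<in> post ?C uc c"
      using en unfolding c enabled_def post_def by (auto simp: trans_C_iff)
    have "enat i < n" using m'(1,2) by (rule less_n)
    from post_p[OF this] m' c(4)
    show "\<exists>ub \<in> enabled S x. \<forall>x' \<in> post S ub x. \<exists>c' \<in> post ?C uc c. (c', x') \<in> Rel"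
      by (intro bexI[of _ "\<upsilon> i"]) (auto simp: Rel_iff intro!: bexI[of _ "e (Suc i, m')"])
  qed
  ultimately show ?thesis
    unfolding approx_alt_sim_def approx_rel_def using met so sys
    by (simp add: state_output_def split_beta)
qed

section \<open>The closed loop, its behaviors and its entry time\<close>

abbreviation F :: "('c \<times> 'x, 'v \<times> 'u, 'x) system" where
  "F \<equiv> feedback C Rel S"

lemma F_transD:
  assumes "((e (i, m), x), w, s) \<in> trans (F :: ('c \<times> 'x, 'v \<times> 'u, 'x) system)"
  shows "\<exists>m'. s = (e (Suc i, m'), p (Suc i)) \<and> Suc i \<le> m' \<and> enat m' \<le> n \<and> (i = 0 \<or> m' = m)"
  using assms by (auto simp: feedback_def trans_C_iff Rel_iff)

lemma F_trans:
  assumes "i \<le> m" "enat m \<le> n" "Suc i \<le> m'" "enat m' \<le> n" "i = 0 \<or> m' = m"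
  shows "((e (i, m), p i), (u, \<upsilon> i), (e (Suc i, m'), p (Suc i)))
           \<in> trans (F :: ('c \<times> 'x, 'v \<times> 'u, 'x) system)"
proof -
  have t: "(e (i, m), u, e (Suc i, m')) \<in> trans (C :: ('c, 'v, 'x) system)"
    using assms unfolding trans_C_iff by blast
  then have "e (Suc i, m') \<in> post (C :: ('c, 'v, 'x) system) u (e (i, m))"
    by (simp add: post_def)
  moreover from this have "u \<in> enabled (C :: ('c, 'v, 'x) system) (e (i, m))"
    by (auto simp: enabled_def chain_controller_def)
  moreover have "enat i < n" using assms less_n by blast
  ultimately have "(e (i, m), p i, u, \<upsilon> i) \<in> extended_rel Rel (C :: ('c, 'v, 'x) system) S"
    using assms post_p[of i]
    by (auto simp: extended_rel_def Rel_iff intro!: bexI[of _ "e (Suc i, m')"])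
  with t p_trans[OF \<open>enat i < n\<close>] assms show ?thesis
    by (auto simp: feedback_def Rel_iff)
qed

lemma run_position:
  assumes "is_run (F :: ('c \<times> 'x, 'v \<times> 'u, 'x) system) (e (0, 0), x0) N \<xi> w" "enat i \<le> N"
  shows "\<exists>m. \<xi> i = (e (i, m), p i) \<and> i \<le> m \<and> enat m \<le> n"
  using assms(2)
proof (induction i)
  case 0
  then show ?case using assms(1) p_0 by (auto simp: is_run_def zero_enat_def[symmetric])
next
  case (Suc i)
  then have "enat i < N" by (simp add: Suc_ile_eq)
  then obtain m where "\<xi> i = (e (i, m), p i)" using Suc.IH by (metis less_imp_le)
  moreover have "(\<xi> i, w i, \<xi> (Suc i)) \<in> trans (F :: ('c \<times> 'x, 'v \<times> 'u, 'x) system)"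
    using assms(1) \<open>enat i < N\<close> by (simp add: is_run_def)
  ultimately show ?case using F_transD by metis
qed

text \<open>The bound is free in the first step and constant afterwards, while the position grows by
  one in each step. A bound \<open>m\<close> chosen first would be exceeded at position
  \<open>Suc m\<close>.\<close>

lemma no_infinite_run:
  "\<not> is_run (F :: ('c \<times> 'x, 'v \<times> 'u, 'x) system) (e (0, 0), x0) \<infinity> \<xi> w"
proof
  assume run: "is_run (F :: ('c \<times> 'x, 'v \<times> 'u, 'x) system) (e (0, 0), x0) \<infinity> \<xi> w"
  have tr: "(\<xi> i, w i, \<xi> (Suc i)) \<in> trans (F :: ('c \<times> 'x, 'v \<times> 'u, 'x) system)" for i
    using run by (simp add: is_run_def)
  obtain m where m: "\<xi> 1 = (e (1, m), p 1)" using run_position[OF run, of 1] by auto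
  have "\<xi> (Suc i) = (e (Suc i, m), p (Suc i))" for i
  proof (induction i)
    case 0
    then show ?case using m by simp
  next
    case (Suc i)
    then show ?case using F_transD[of "Suc i" m] tr[of "Suc i"] by (metis nat.distinct(1))
  qed
  moreover have "\<exists>m'. \<xi> (Suc m) = (e (Suc m, m'), p (Suc m)) \<and> Suc m \<le> m'"
    using run_position[OF run, of "Suc m"] by auto
  ultimately show False by (auto simp: e_eq)
qed

text \<open>Outputs depend on the position alone, so the bound is invisible in a behavior. Every
  finite length up to \<open>n\<close> occurs, but an infinite behavior never does.\<close>

lemma F_behaviors:
  "behaviors (F :: ('c \<times> 'x, 'v \<times> 'u, 'x) system) (e (0, 0), x0)
     = {Finite (map p [0..<Suc l]) | l. enat l \<le> n}" (is "?B = ?P")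
proof (intro subset_antisym subsetI)
  fix b assume "b \<in> ?B"
  then obtain l \<xi> w where run: "is_run (F :: ('c \<times> 'x, 'v \<times> 'u, 'x) system) (e (0, 0), x0) (enat l) \<xi> w"
    and b: "b = Finite (map (\<lambda>i. out (F :: ('c \<times> 'x, 'v \<times> 'u, 'x) system) (\<xi> i)) [0..<Suc l])"
    using no_infinite_run unfolding behaviors_def by blast
  have "out (F :: ('c \<times> 'x, 'v \<times> 'u, 'x) system) (\<xi> i) = p i" if il: "i \<le> l" for i
  proof -
    obtain m where "\<xi> i = (e (i, m), p i)" using run_position[OF run, of i] il by auto
    then show ?thesis using out_C[of i m] by (simp add: feedback_def)
  qed
  then have "b = Finite (map p [0..<Suc l])" using b by (simp add: map_eq_conv)
  moreover have "enat l \<le> n" using run_position[OF run, of l] le_n by auto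
  ultimately show "b \<in> ?P" by blast
next
  fix b assume "b \<in> ?P"
  then obtain l where b: "b = Finite (map p [0..<Suc l])" and l: "enat l \<le> n" by blast
  \<comment> \<open>The initial state carries the bound \<open>0\<close>; the first step chooses
    \<open>l\<close>, so that the run can last exactly \<open>l\<close> steps.\<close>
  define \<xi> where "\<xi> i = (e (i, if i = 0 then 0 else l), p i)" for i
  have "(\<xi> i, (undefined, \<upsilon> i), \<xi> (Suc i)) \<in> trans (F :: ('c \<times> 'x, 'v \<times> 'u, 'x) system)"
    if "i < l" for i
    using F_trans[of i "if i = 0 then 0 else l" l undefined] that l
    by (auto simp: \<xi>_def zero_enat_def[symmetric])
  moreover have "(e (0, 0), x0) \<in> states (F :: ('c \<times> 'x, 'v \<times> 'u, 'x) system)"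
    using p_0 by (simp add: feedback_def Rel_iff zero_enat_def[symmetric])
  ultimately have "is_run (F :: ('c \<times> 'x, 'v \<times> 'u, 'x) system) (e (0, 0), x0) (enat l) \<xi>
      (\<lambda>i. (undefined, \<upsilon> i))"
    using p_0 by (simp add: is_run_def \<xi>_def)
  moreover have "out (F :: ('c \<times> 'x, 'v \<times> 'u, 'x) system) (\<xi> i) = p i" for i
    by (simp add: feedback_def \<xi>_def out_C)
  ultimately show "b \<in> ?B" unfolding b finite_behavior_iff by force
qed

text \<open>For finite \<open>n\<close> only the full word is maximal, and it ends in
  \<open>W\<close>. For infinite \<open>n\<close> no behavior is maximal, so every \<open>k\<close>
  is a bound.\<close>

lemma F_entry_time:
  assumes "\<And>m. n = enat m \<Longrightarrow> m \<le> k \<and> p m \<in> W"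
  shows "entry_time (F :: ('c \<times> 'x, 'v \<times> 'u, 'x) system) W (e (0, 0), x0) \<le> enat k"
  unfolding entry_time_le_iff
proof
  fix b assume max: "b \<in> maximal_behaviors (F :: ('c \<times> 'x, 'v \<times> 'u, 'x) system) (e (0, 0), x0)"
  then obtain l where b: "b = Finite (map p [0..<Suc l])" "enat l \<le> n"
    unfolding maximal_behaviors_def F_behaviors by blast
  have "n = enat l"
  proof (rule ccontr)
    assume "n \<noteq> enat l"
    with b(2) have "enat (Suc l) \<le> n" by (simp add: Suc_ile_eq)
    moreover have "proper_prefix b (Finite (map p [0..<Suc (Suc l)]))"
      by (simp add: b strict_prefix_def)
    ultimately show False using max unfolding maximal_behaviors_def F_behaviors by blast
  qed
  with assms[of l] b show "\<exists>k' \<le> k. in_at b k' W"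
    by (auto simp: nth_append intro!: exI[of _ l])
qed

end

text \<open>The controller following the run is a competitor of the optimal one, and it meets the
  bound \<open>k\<close> at \<open>x0\<close>.\<close>

lemma optimal_entry_time_le:
  fixes Sc :: "('c, 'v, 'x) system"
  assumes "infinite (UNIV :: 'c set)" and "is_system S" and "deterministic S" and "state_output S"
    and "Metric_space (states S) d" and "x0 \<in> init S" and "is_run S x0 n p \<upsilon>"
    and W: "\<And>m. n = enat m \<Longrightarrow> m \<le> k \<and> p m \<in> W"
    and opt: "time_optimal d S W Sc Rc"
  shows "comp_entry_time Sc Rc S W x0 \<le> enat k"
proof -
  obtain f :: "nat \<Rightarrow> 'c" where "inj f"
    using assms(1) by (auto simp: infinite_iff_countable_subset)
  \<comment> \<open>Pairs of naturals are coded by naturals, which embed into the infinite type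
    \<open>'c\<close>.\<close>
  define e where "e = f \<circ> prod_encode"
  have "inj e" unfolding e_def using \<open>inj f\<close> by (simp add: inj_compose inj_prod_encode)
  interpret followed_run e S x0 n p \<upsilon> d
    by (intro followed_run.intro) (fact | fact \<open>inj e\<close>)+
  let ?C = "C :: ('c, 'v, 'x) system"
  have root: "(e (0, 0), x0) \<in> init (feedback ?C Rel S)" "e (0, 0) \<in> init ?C"
    using init p_0 by (auto simp: feedback_def Rel_iff chain_controller_def zero_enat_def[symmetric])
  have time: "entry_time (feedback ?C Rel S) W (e (0, 0), x0) \<le> enat k"
    using F_entry_time W by blast
  \<comment> \<open>Membership asks for one good initial state only, and the root is one by its
    finite entry time.\<close>
  then have "(?C, Rel) \<in> reach_pairs d S W"
    using root chain_alt_sim unfolding entry_time_le_iff reach_pairs_def by blast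
  then have "comp_entry_time Sc Rc S W x0 \<le> comp_entry_time ?C Rel S W x0"
    using opt init unfolding time_optimal_def by blast
  also have "\<dots> \<le> entry_time (feedback ?C Rel S) W (e (0, 0), x0)"
    unfolding comp_entry_time_def using root by (intro Inf_lower) blast
  finally show ?thesis using time by simp
qed


section \<open>Comparison of the optimal entry times\<close>

text \<open>Distance at most \<open>0\<close> in a metric space means equality, and the output of a
  plant state is the state itself.\<close>

lemma exact_out_eq:
  assumes "approx_alt_sim d 0 Rc Sc S" "state_output S" "(c, x) \<in> Rc"
  shows "out Sc c = x"
proof -
  have sys: "is_system Sc" "outputs Sc = outputs S" "Metric_space (outputs Sc) d"
    "Rc \<subseteq> states Sc \<times> states S" "d (out Sc c) (out S x) \<le> 0"
    using assms(1,3) by (auto simp: approx_alt_sim_def approx_rel_def)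
  then interpret Metric_space "outputs Sc" d by blast
  have "c \<in> states Sc" "x \<in> states S" using sys(4) assms(3) by auto
  then have "out S x = x" "x \<in> outputs Sc" "out Sc c \<in> outputs Sc"
    using sys(1,2) assms(2) by (auto simp: state_output_def is_system_def)
  then show ?thesis using sys(5) zero nonneg by (metis order_antisym)
qed

lemma optimal_reach: "time_optimal d S W Sc Rc \<Longrightarrow> approx_alt_sim d 0 Rc Sc S"
  by (auto simp: time_optimal_def reach_pairs_def)

lemma enat_le_by_finite_bounds:
  assumes "\<And>k. y \<le> enat k \<Longrightarrow> x \<le> enat k"
  shows "x \<le> y"
  using assms by (cases y) auto

text \<open>This is the common form of both inequalities: the closed loop around \<open>S1\<close>
  is matched by a run of \<open>S2\<close>, which an optimal controller of \<open>S2\<close> then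
  cannot be slower than. For each enabled input one suitable successor is enough.\<close>

lemma optimal_comparison:
  fixes Sc2 :: "('c2, 'v2, 'x2) system"
  assumes inf: "infinite (UNIV :: 'c2 set)" and S2: "is_system S2" "deterministic S2"
      "state_output S2" "Metric_space (states S2) d2" "x2 \<in> init S2"
    and opt2: "time_optimal d2 S2 W2 Sc2 Rc2"
    and S1: "state_output S1" and sim1: "approx_alt_sim d1 0 Rc1 Sc1 S1"
    and rel: "(x1, x2) \<in> Q"
    and target: "\<And>y z. y \<in> W1 \<Longrightarrow> (y, z) \<in> Q \<Longrightarrow> z \<in> W2"
    and step: "\<And>x u z. u \<in> enabled S1 x \<Longrightarrow> (x, z) \<in> Q \<Longrightarrow>
      \<exists>x' \<in> post S1 u x. \<exists>v z'. (z, v, z') \<in> trans S2 \<and> (x', z') \<in> Q"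
  shows "comp_entry_time Sc2 Rc2 S2 W2 x2 \<le> comp_entry_time Sc1 Rc1 S1 W1 x1"
proof (rule enat_le_by_finite_bounds)
  fix k assume "comp_entry_time Sc1 Rc1 S1 W1 x1 \<le> enat k"
  then obtain c where c: "(c, x1) \<in> init (feedback Sc1 Rc1 S1)"
    "entry_time (feedback Sc1 Rc1 S1) W1 (c, x1) \<le> enat k"
    by (rule comp_entry_time_leD)
  let ?T = "feedback Sc1 Rc1 S1"
  have out: "out ?T (c, x) = x" if "(c, x) \<in> Rc1" for c x
    using exact_out_eq[OF sim1 S1 that] by (simp add: feedback_def)
  have "\<exists>n \<zeta> \<upsilon>. is_run S2 x2 n \<zeta> \<upsilon> \<and> (\<forall>m. n = enat m \<longrightarrow> m \<le> k \<and> \<zeta> m \<in> W2)"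
  proof (rule entry_time_matching_run[OF c(2)])
    show "(c, x1) \<in> states ?T" using c(1) by (simp add: feedback_def)
    show "x2 \<in> states S2" using S2(1,5) by (auto simp: is_system_def)
    show "(out ?T (c, x1), x2) \<in> Q" using c(1) out[of c x1] rel by (simp add: feedback_def)
    show "z \<in> W2" if "y \<in> W1" "(y, z) \<in> Q" for y z using target that by blast
  next
    fix s u s' z assume tr: "(s, u, s') \<in> trans ?T" and Q: "(out ?T s, z) \<in> Q"
    then obtain c x uc ux where s: "s = (c, x)" "u = (uc, ux)"
      and ext: "(c, x, uc, ux) \<in> extended_rel Rc1 Sc1 S1"
      by (auto simp: feedback_def)
    then have cx: "(c, x) \<in> Rc1" and ux: "ux \<in> enabled S1 x"
      by (auto simp: extended_rel_def)
    with Q out s have "(x, z) \<in> Q" by simp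
    then obtain x' v z' where x': "x' \<in> post S1 ux x" and z': "(z, v, z') \<in> trans S2" "(x', z') \<in> Q"
      using step ux by blast
    \<comment> \<open>The extended relation matches every plant successor with a controller
      successor, so the loop can also take the chosen \<open>x'\<close>, even if the given
      transition led elsewhere.\<close>
    then obtain c' where c': "c' \<in> post Sc1 uc c" "(c', x') \<in> Rc1"
      using ext by (auto simp: extended_rel_def)
    then have "((c, x), (uc, ux), (c', x')) \<in> trans ?T"
      using ext cx x' by (auto simp: feedback_def post_def)
    with s z' c'(2) out
    show "\<exists>u s' v z'. (s, u, s') \<in> trans ?T \<and> (z, v, z') \<in> trans S2 \<and> (out ?T s', z') \<in> Q"
      by metis
  qed
  then obtain n \<zeta> \<upsilon> where "is_run S2 x2 n \<zeta> \<upsilon>" "\<And>m. n = enat m \<Longrightarrow> m \<le> k \<and> \<zeta> m \<in> W2"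
    by blast
  then show "comp_entry_time Sc2 Rc2 S2 W2 x2 \<le> enat k"
    by (rule optimal_entry_time_le[OF inf S2 _ _ opt2])
qed

section \<open>The associated deterministic system and the final comparison\<close>

lemma is_system_det_system: "is_system S \<Longrightarrow> is_system (det_system S)"
  by (auto simp: is_system_def det_system_def)

lemma deterministic_det_system: "deterministic (det_system S)"
  by (auto simp: deterministic_def det_system_def post_def)

lemma state_output_det_system: "state_output (det_system S) \<longleftrightarrow> state_output S"
  by (simp add: state_output_def det_system_def)

theorem theorem3p6:
  fixes d :: "'x \<Rightarrow> 'x \<Rightarrow> real" and \<epsilon> :: real
    and Sa :: "('x, 'ua, 'x) system" and Sb :: "('x, 'ub, 'x) system"
    and R :: "('x \<times> 'x) set" and W :: "'x set" and xa0 xb0 :: 'x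
    and Sca :: "('ca, 'va, 'x) system" and Rca :: "('ca \<times> 'x) set"
    and Scb :: "('cb, 'vb, 'x) system" and Rcb :: "('cb \<times> 'x) set"
    and Scd :: "('cd, 'vd, 'x) system" and Rcd :: "('cd \<times> 'x) set"
  assumes "infinite (UNIV :: 'cb set)" and "infinite (UNIV :: 'cd set)"
    and "\<epsilon> \<ge> 0"
    and "is_system Sa" and "is_system Sb"
    and "state_output Sa" and "state_output Sb"
    and "deterministic Sb"
    and "approx_alt_sim d \<epsilon> R Sa Sb"
    and "approx_sim d \<epsilon> (R\<inverse>) Sb Sa"
    and "W \<subseteq> states Sb"
    and "xa0 \<in> init Sa" and "xb0 \<in> init Sb" and "(xa0, xb0) \<in> R"
    and "time_optimal d Sb W Scb Rcb"
    and "time_optimal d Sa (rel_floor (states Sa) R W) Sca Rca"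
    and "time_optimal d (det_system Sa) (rel_ceil (states Sa) R W) Scd Rcd"
  shows "comp_entry_time Scd Rcd (det_system Sa) (rel_ceil (states Sa) R W) xa0
           \<le> comp_entry_time Scb Rcb Sb W xb0
         \<and> comp_entry_time Scb Rcb Sb W xb0
           \<le> comp_entry_time Sca Rca Sa (rel_floor (states Sa) R W) xa0"
proof
  note alt = \<open>approx_alt_sim d \<epsilon> R Sa Sb\<close> and sim = \<open>approx_sim d \<epsilon> (R\<inverse>) Sb Sa\<close>
  have met: "Metric_space (states Sa) d" and eq: "states Sa = states Sb"
    using alt \<open>state_output Sa\<close> \<open>state_output Sb\<close>
    by (auto simp: approx_alt_sim_def approx_rel_def state_output_def)
  have R: "R \<subseteq> states Sa \<times> states Sb"
    using alt by (auto simp: approx_alt_sim_def approx_rel_def)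
  show "comp_entry_time Scd Rcd (det_system Sa) (rel_ceil (states Sa) R W) xa0
          \<le> comp_entry_time Scb Rcb Sb W xb0"
  proof (rule optimal_comparison[where Q = "R\<inverse>" and ?d1.0 = d and ?d2.0 = d])
    show "infinite (UNIV :: 'cd set)" by fact
    show "is_system (det_system Sa)" "deterministic (det_system Sa)" "state_output (det_system Sa)"
      using \<open>is_system Sa\<close> \<open>state_output Sa\<close>
      by (simp_all add: is_system_det_system deterministic_det_system state_output_det_system)
    show "Metric_space (states (det_system Sa)) d" "xa0 \<in> init (det_system Sa)"
      using met \<open>xa0 \<in> init Sa\<close> by (simp_all add: det_system_def)
    show "approx_alt_sim d 0 Rcb Scb Sb" using assms by (simp add: optimal_reach)
    show "z \<in> rel_ceil (states Sa) R W" if "y \<in> W" "(y, z) \<in> R\<inverse>" for y z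
      using that R by (auto simp: rel_ceil_def)
    show "\<exists>x' \<in> post Sb u x. \<exists>v z'. (z, v, z') \<in> trans (det_system Sa) \<and> (x', z') \<in> R\<inverse>"
      if u: "u \<in> enabled Sb x" and xz: "(x, z) \<in> R\<inverse>" for x u z
    proof -
      \<comment> \<open>Any successor of \<open>x\<close> will do here, as the simulation by
        \<open>Sa\<close> answers each transition. The answer becomes a transition of
        \<open>det_system Sa\<close> once its target is added to the label.\<close>
      obtain x' where x': "(x, u, x') \<in> trans Sb" using u by (auto simp: enabled_def post_def)
      then obtain v z' where "(z, v, z') \<in> trans Sa" "(x', z') \<in> R\<inverse>"
        using sim xz unfolding approx_sim_def by blast
      with x' show ?thesis by (fastforce simp: post_def det_system_def)
    qed
  qed (use assms in auto)
  show "comp_entry_time Scb Rcb Sb W xb0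
          \<le> comp_entry_time Sca Rca Sa (rel_floor (states Sa) R W) xa0"
  proof (rule optimal_comparison[where Q = R and ?d1.0 = d and ?d2.0 = d])
    show "infinite (UNIV :: 'cb set)" by fact
    show "Metric_space (states Sb) d" using met eq by simp
    show "approx_alt_sim d 0 Rca Sca Sa" using assms by (simp add: optimal_reach)
    show "z \<in> W" if "y \<in> rel_floor (states Sa) R W" "(y, z) \<in> R" for y z
      using that by (auto simp: rel_floor_def)
    show "\<exists>x' \<in> post Sa u x. \<exists>v z'. (z, v, z') \<in> trans Sb \<and> (x', z') \<in> R"
      if u: "u \<in> enabled Sa x" and xz: "(x, z) \<in> R" for x u z
    proof -
      \<comment> \<open>Since \<open>v\<close> is enabled it has some successor \<open>z'\<close>,
        and the alternating condition then selects the \<open>x'\<close> to be matched with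
        it.\<close>
      obtain v where "v \<in> enabled Sb z" "\<forall>z' \<in> post Sb v z. \<exists>x' \<in> post Sa u x. (x', z') \<in> R"
        using alt u xz unfolding approx_alt_sim_def by blast
      then show ?thesis by (fastforce simp: enabled_def post_def)
    qed
  qed (use assms in auto)
qed

end
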